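(* For every $d>0$ that is realized as the Euclidean distance between two points of $\mathbb{Q}^3$, the complete bipartite graph $K_{2,3}$ is (isomorphic to) a subgraph of $G(\mathbb{Q}^3,d)$.
   Context: For $S \subseteq \mathbb{R}$, a positive integer $n$ and $d>0$, $G(S^n,d)$ denotes the graph with vertex set $S^n$ in which two vertices are adjacent if and only if their Euclidean distance is exactly $d$. Subgraphs need not be induced. *)

theory Defs
  imports "HOL-Analysis.Analysis" "Graph_Theory.Kuratowski"
begin

text \<open>The power \<open>S\<^sup>n\<close> inside Euclidean \<open>n\<close>-space, with \<open>n = CARD('n)\<close>.\<close>

definition cart_power :: "real set \<Rightarrow> (real ^ 'n) set" where
  "cart_power S = {x. \<forall>i. x $ i \<in> S}"

text \<open>
  The graph \<open>G(S\<^sup>n, d)\<close>. As usual in \<open>Graph_Theory\<close>, an undirected graph is a symmetric digraph,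
  so an edge \<open>{x, y}\<close> is the pair of arcs \<open>(x, y)\<close> and \<open>(y, x)\<close>.
\<close>

definition distance_graph :: "real set \<Rightarrow> real \<Rightarrow> (real ^ 'n) pair_pre_digraph" where
  "distance_graph S d =
     \<lparr> pverts = cart_power S,
       parcs = {(x, y). x \<in> cart_power S \<and> y \<in> cart_power S \<and> dist x y = d} \<rparr>"

lemma pair_bidirected_digraph_distance_graph:
  assumes "d > 0"
  shows "pair_bidirected_digraph (distance_graph S d)"
  using assms
  by unfold_locales
    (auto simp: distance_graph_def symmetric_def dist_commute intro!: symI)

end

theory Submission
  imports Defs "HOL-Analysis.Cross3"
begin

text \<open>
  Let \<open>v \<in> \<rat>\<^sup>3\<close> have norm \<open>d\<close>. Permuting the coordinates of \<open>v\<close> or changing a sign gives \<open>w \<in> \<rat>\<^sup>3\<close>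
  of the same norm with \<open>w \<noteq> \<plusminus>v\<close>, so \<open>p = (v + w)/2\<close> and \<open>t = (v - w)/2\<close> are nonzero, orthogonal
  and satisfy \<open>|p|\<^sup>2 + |t|\<^sup>2 = d\<^sup>2\<close>. Every vector orthogonal to \<open>p\<close> of length \<open>|t|\<close> has distance \<open>d\<close>
  from both \<open>p\<close> and \<open>-p\<close>. Three such rational vectors are \<open>t\<close>, \<open>-t\<close> and the rotation of \<open>t\<close> about
  the axis \<open>p\<close> whose half-angle has tangent \<open>|p|\<close>.
\<close>

lemma cart_power_Rats_add: "x \<in> cart_power \<rat> \<Longrightarrow> y \<in> cart_power \<rat> \<Longrightarrow> x + y \<in> cart_power \<rat>"
  by (simp add: cart_power_def)

lemma cart_power_Rats_diff: "x \<in> cart_power \<rat> \<Longrightarrow> y \<in> cart_power \<rat> \<Longrightarrow> x - y \<in> cart_power \<rat>"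
  by (simp add: cart_power_def)

lemma cart_power_Rats_uminus: "x \<in> cart_power \<rat> \<Longrightarrow> - x \<in> cart_power \<rat>"
  by (simp add: cart_power_def)

lemma cart_power_Rats_scaleR: "c \<in> \<rat> \<Longrightarrow> x \<in> cart_power \<rat> \<Longrightarrow> c *\<^sub>R x \<in> cart_power \<rat>"
  by (simp add: cart_power_def)

lemma cart_power_Rats_cross3:
  "x \<in> cart_power \<rat> \<Longrightarrow> y \<in> cart_power \<rat> \<Longrightarrow> cross3 x y \<in> cart_power \<rat>"
  by (simp add: cart_power_def forall_3 cross_components)

lemma cart_power_Rats_inner: "x \<in> cart_power \<rat> \<Longrightarrow> y \<in> cart_power \<rat> \<Longrightarrow> x \<bullet> y \<in> \<rat>"
  by (auto simp: cart_power_def inner_vec_def intro!: Rats_sum)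

lemmas cart_power_Rats_intros =
  cart_power_Rats_add cart_power_Rats_diff cart_power_Rats_uminus cart_power_Rats_scaleR
  cart_power_Rats_cross3 cart_power_Rats_inner

text \<open>Reduces the theorem to exhibiting two finite sets of points at mutual distance
  \<open>d\<close>. Positivity of \<open>d\<close> makes them disjoint, and keeping only the arcs
  between them suffices because a subgraph need not be induced.\<close>

lemma complete_bipartite_subgraph_distance_graph:
  fixes U V :: "(real ^ 'n) set"
  assumes "d > 0" and UV: "U \<subseteq> cart_power S" "V \<subseteq> cart_power S"
    and fin: "finite U" "finite V"
    and dist: "\<And>u v. u \<in> U \<Longrightarrow> v \<in> V \<Longrightarrow> dist u v = d"
  shows "\<exists>H. subgraph H (with_proj (distance_graph S d :: (real ^ 'n) pair_pre_digraph))
           \<and> K\<^bsub>card U,card V\<^esub> H"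
proof -
  define H where "H = \<lparr> pverts = U \<union> V, parcs = U \<times> V \<union> V \<times> U \<rparr>"
  have disj: "U \<inter> V = {}"
    using dist \<open>d > 0\<close> by force
  interpret G: pair_bidirected_digraph "distance_graph S d :: (real ^ 'n) pair_pre_digraph"
    using \<open>d > 0\<close> by (rule pair_bidirected_digraph_distance_graph)
  interpret H: pair_graph H
    using fin disj by unfold_locales (auto simp: H_def symmetric_def intro!: symI)
  have "parcs H \<subseteq> parcs (distance_graph S d)"
    using UV dist by (auto simp: H_def distance_graph_def) (metis dist_commute)
  then have "subgraph (with_proj H) (with_proj (distance_graph S d))"
    using UV G.wf_digraph H.wf_digraph
    by (auto simp: subgraph_def compatible_def H_def distance_graph_def)
  moreover have "K\<^bsub>card U,card V\<^esub> (with_proj H)"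
    unfolding complete_bipartite_digraph_def
    using H.graph_axioms disj by (auto simp: H_def)
  ultimately show ?thesis
    by blast
qed

lemma ex_rational_same_norm:
  fixes v :: "real ^ 3"
  assumes v: "v \<in> cart_power \<rat>" "v \<noteq> 0"
  obtains w where "w \<in> cart_power \<rat>" "norm w = norm v" "w \<noteq> v" "w \<noteq> - v"
proof (cases "v$1 = v$2 \<and> v$2 = v$3")
  case True
  \<comment> \<open>The common coordinate is nonzero, so flipping one sign out of three gives
    neither \<open>v\<close> nor \<open>- v\<close>.\<close>
  let ?w = "vector [v$1, v$2, - v$3] :: real ^ 3"
  show ?thesis
  proof
    show "?w \<in> cart_power \<rat>" "norm ?w = norm v" "?w \<noteq> v" "?w \<noteq> - v"
      using v True
      by (auto simp: cart_power_def forall_3 vec_eq_iff norm_eq_sqrt_inner inner_vec_def sum_3)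
  qed
next
  case False
  \<comment> \<open>A cyclic shift fixes only constant vectors; if it negated \<open>v\<close>,
    applying it three times would give \<open>v = - v\<close>.\<close>
  let ?w = "vector [v$2, v$3, v$1] :: real ^ 3"
  show ?thesis
  proof
    show "?w \<in> cart_power \<rat>" "norm ?w = norm v" "?w \<noteq> v" "?w \<noteq> - v"
      using v False
      by (auto simp: cart_power_def forall_3 vec_eq_iff norm_eq_sqrt_inner inner_vec_def sum_3)
  qed
qed

lemma ex_rational_rotation:
  fixes p t :: "real ^ 3"
  assumes rat: "p \<in> cart_power \<rat>" "t \<in> cart_power \<rat>"
    and "p \<noteq> 0" "t \<noteq> 0" "p \<bullet> t = 0"
  obtains s where "s \<in> cart_power \<rat>" "p \<bullet> s = 0" "norm s = norm t" "s \<noteq> t" "s \<noteq> - t"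
proof
  define N where "N = p \<bullet> p"
  define c where "c = cross3 p t"
  \<comment> \<open>Rodrigues' formula. With half-angle tangent |p|, the cosine is (1 - N)/(1 + N)
    and the sine 2|p|/(1 + N); the possibly irrational |p| is absorbed by \<open>c\<close>, which is
    |p| times the quarter turn of \<open>t\<close> about \<open>p\<close>.\<close>
  define s where "s = ((1 - N) / (1 + N)) *\<^sub>R t + (2 / (1 + N)) *\<^sub>R c"
  have N: "N > 0" "N \<in> \<rat>"
    using assms by (auto simp: N_def cart_power_Rats_inner)
  have orth: "t \<bullet> c = 0" "c \<bullet> t = 0" "p \<bullet> c = 0"
    by (auto simp: c_def dot_cross_self inner_commute)
  have cc: "c \<bullet> c = N * (t \<bullet> t)"
    using norm_cross_dot[of p t] assms
    by (simp add: c_def N_def power_mult_distrib dot_square_norm)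
  show "s \<in> cart_power \<rat>"
    using N rat by (auto simp: s_def c_def intro!: cart_power_Rats_intros)
  show "p \<bullet> s = 0"
    using assms orth by (simp add: s_def inner_add_right)
  have "s \<bullet> s = (((1 - N) / (1 + N))\<^sup>2 + (2 / (1 + N))\<^sup>2 * N) * (t \<bullet> t)"
    unfolding s_def inner_add_right inner_add_left inner_scaleR_left inner_scaleR_right orth cc
    by (simp only: power2_eq_square distrib_right mult.assoc mult_zero_right add_0_left add_0_right)
  \<comment> \<open>This is cos^2 + sin^2 = 1 for the rotation angle.\<close>
  also have "((1 - N) / (1 + N))\<^sup>2 + (2 / (1 + N))\<^sup>2 * N = 1"
  proof -
    have "(1 - N)\<^sup>2 + 2\<^sup>2 * N = (1 + N)\<^sup>2"
      by (simp add: power2_eq_square algebra_simps)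
    then show ?thesis
      using N by (simp add: power_divide flip: add_divide_distrib)
  qed
  finally show "norm s = norm t"
    by (simp add: norm_eq_sqrt_inner)
  \<comment> \<open>The component along \<open>c\<close> separates \<open>s\<close> from both
    \<open>t\<close> and \<open>- t\<close>, which are orthogonal to \<open>c\<close>.\<close>
  have "c \<bullet> s \<noteq> 0"
    using N assms by (simp add: s_def inner_add_right orth cc)
  then show "s \<noteq> t" "s \<noteq> - t"
    using orth by auto
qed

theorem theorem3p3:
  fixes d :: real
  assumes "d > 0"
    and "\<exists>x \<in> (cart_power \<rat> :: (real ^ 3) set). \<exists>y \<in> cart_power \<rat>. dist x y = d"
  shows "\<exists>H. subgraph H (with_proj (distance_graph \<rat> d :: (real ^ 3) pair_pre_digraph))
           \<and> K\<^bsub>2,3\<^esub> H"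
proof -
  obtain x y :: "real ^ 3" where xy: "x \<in> cart_power \<rat>" "y \<in> cart_power \<rat>" "dist x y = d"
    using assms(2) by blast
  define v where "v = x - y"
  have v: "v \<in> cart_power \<rat>" "norm v = d" "v \<noteq> 0"
    using xy \<open>d > 0\<close> by (auto simp: v_def dist_norm cart_power_Rats_diff)
  obtain w where w: "w \<in> cart_power \<rat>" "norm w = norm v" "w \<noteq> v" "w \<noteq> - v"
    using ex_rational_same_norm v by blast
  define p t where "p = (1/2) *\<^sub>R (v + w)" and "t = (1/2) *\<^sub>R (v - w)"
  have rat: "p \<in> cart_power \<rat>" "t \<in> cart_power \<rat>"
    using v w by (auto simp: p_def t_def intro!: cart_power_Rats_intros)
  have nz: "p \<noteq> 0" "t \<noteq> 0"
    using w by (auto simp: p_def t_def add_eq_0_iff)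
  have ww: "w \<bullet> w = v \<bullet> v"
    using w by (simp add: dot_square_norm)
  \<comment> \<open>The product is (|v|^2 - |w|^2)/4: the diagonals of a rhombus are
    perpendicular.\<close>
  have pt: "p \<bullet> t = 0"
    using ww by (simp add: p_def t_def inner_add_left inner_diff_right inner_commute[of w v])
  have "p + t = v"
    by (simp add: p_def t_def flip: scaleR_add_right)
  then have d2: "(norm p)\<^sup>2 + (norm t)\<^sup>2 = d\<^sup>2"
    using pt v norm_add_Pythagorean[of p t] by (simp add: orthogonal_def)
  obtain s where s: "s \<in> cart_power \<rat>" "p \<bullet> s = 0" "norm s = norm t" "s \<noteq> t" "s \<noteq> - t"
    using ex_rational_rotation rat nz pt by blast
  have dist: "dist u r = d" if "u \<in> {p, - p}" "r \<in> {t, - t, s}" for u r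
  proof -
    have "orthogonal u (- r)" "norm u = norm p" "norm r = norm t"
      using that pt s by (auto simp: orthogonal_def)
    then have "(dist u r)\<^sup>2 = d\<^sup>2"
      using norm_add_Pythagorean[of u "- r"] d2 by (simp add: dist_norm)
    then show ?thesis
      using \<open>d > 0\<close> by (simp add: power2_eq_iff_nonneg)
  qed
  have "p \<noteq> - p" "t \<noteq> - t"
    using nz by (simp_all add: eq_neg_iff_add_eq_0 flip: scaleR_2)
  then have "card {p, - p} = 2" "card {t, - t, s} = 3"
    using s by auto
  moreover have "{p, - p} \<subseteq> cart_power \<rat>" "{t, - t, s} \<subseteq> cart_power \<rat>"
    using rat s by (auto intro: cart_power_Rats_uminus)
  ultimately show ?thesis
    using complete_bipartite_subgraph_distance_graph[of d "{p, - p}" \<rat> "{t, - t, s}"] dist \<open>d > 0\<close>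
    by auto
qed

end
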